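(* For any graph $G$ (with complement $\overline{G}$, and with $\overline{M}(G)$ denoting the complement of the Mycielski graph $M(G)$): (a) $i_4(\overline{G})\leq 4$ if and only if $p_v(\overline{M}(G))=1$; (b) for every integer $r\ge 3$, $\lceil i_4(\overline{G})/2\rceil=r$ if and only if $p_v(\overline{M}(G))=r-1$.
   Context: Graphs are finite, simple, undirected. For $G$ with $V=\{v_1,\dots,v_n\}$, the Mycielski graph $M(G)$ has vertex set $V\cup\{v_1',\dots,v_n'\}\cup\{u\}$ and edge set $E\cup\{v_iv_j' : v_iv_j\in E\}\cup\{v_i'u: 1\le i\le n\}$. A 4-star matching of a graph $H$ is a subgraph of $H$ each of whose connected components is isomorphic to a star $K_{1,i}$ with $1\le i\le 4$; $s_4(H)$ is the maximum number of vertices of a 4-star matching of $H$, and $i_4(H)=|V(H)|-s_4(H)$. The path covering number $p_v(H)$ is the smallest number of vertex-disjoint paths covering all vertices of $H$. *)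

theory Defs
  imports "Graph_Theory.Graph_Theory"
begin

text \<open>
  A finite simple undirected graph is a \<^locale>\<open>pair_graph\<close>: the edge \<open>uv\<close> is represented by the
  two arcs \<open>(u, v)\<close> and \<open>(v, u)\<close>. The null graph is included.
\<close>

definition complement :: "'a pair_pre_digraph \<Rightarrow> 'a pair_pre_digraph" where
  "complement G = \<lparr> pverts = pverts G,
     parcs = {(u, v). u \<in> pverts G \<and> v \<in> pverts G \<and> u \<noteq> v \<and> (u, v) \<notin> parcs G} \<rparr>"

datatype 'a mycielski_vertex = Orig 'a | Copy 'a | Apex

definition mycielski :: "'a pair_pre_digraph \<Rightarrow> 'a mycielski_vertex pair_pre_digraph" where
  "mycielski G = \<lparr> pverts = Orig ` pverts G \<union> Copy ` pverts G \<union> {Apex},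
     parcs = {(Orig v, Orig w) | v w. (v, w) \<in> parcs G}
       \<union> {(Orig v, Copy w) | v w. (v, w) \<in> parcs G}
       \<union> {(Copy w, Orig v) | v w. (v, w) \<in> parcs G}
       \<union> {(Copy v, Apex) | v. v \<in> pverts G}
       \<union> {(Apex, Copy v) | v. v \<in> pverts G} \<rparr>"

text \<open>
  \<open>S\<close> is symmetric, so its strongly connected components are its connected components.
  The null graph is a star matching, as it has no components.
\<close>

definition star_matching :: "nat \<Rightarrow> 'a pair_pre_digraph \<Rightarrow> 'a pair_pre_digraph \<Rightarrow> bool" where
  "star_matching k S H \<longleftrightarrow> pair_graph S \<and> subgraph (with_proj S) (with_proj H) \<and>
     (\<forall>C \<in> pre_digraph.sccs (with_proj S). \<exists>i \<in> {1..k}. complete_bipartite_digraph 1 i C)"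

definition star_matching_number :: "nat \<Rightarrow> 'a pair_pre_digraph \<Rightarrow> nat" where
  "star_matching_number k H = Max {card (pverts S) | S. star_matching k S H}"

definition star_deficiency :: "nat \<Rightarrow> 'a pair_pre_digraph \<Rightarrow> nat" where
  "star_deficiency k H = card (pverts H) - star_matching_number k H"

text \<open>
  A path is given by a nonempty duplicate-free list of consecutively adjacent vertices; a single
  vertex is a path.
\<close>

definition path_cover :: "'a list set \<Rightarrow> 'a pair_pre_digraph \<Rightarrow> bool" where
  "path_cover P H \<longleftrightarrow> finite P \<and> (\<forall>p \<in> P. vpath p (with_proj H)) \<and>
     (\<forall>p \<in> P. \<forall>q \<in> P. p \<noteq> q \<longrightarrow> set p \<inter> set q = {}) \<and> (\<Union>p \<in> P. set p) = pverts H"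

definition path_covering_number :: "'a pair_pre_digraph \<Rightarrow> nat" where
  "path_covering_number H = (LEAST k. \<exists>P. path_cover P H \<and> card P = k)"

lemma pair_graph_complement:
  assumes "pair_graph G"
  shows "pair_graph (complement G)"
proof -
  interpret pair_graph G by fact
  have "parcs (complement G) \<subseteq> pverts G \<times> pverts G"
    by (auto simp: complement_def)
  then have "finite (parcs (complement G))"
    by (rule finite_subset) (simp add: pair_finite_verts)
  moreover have "sym (parcs G)"
    using pair_sym_arcs by (simp add: symmetric_def)
  ultimately show ?thesis
    by unfold_locales
       (auto simp: complement_def symmetric_def pair_finite_verts intro!: symI dest: symD)
qed

lemma pair_graph_mycielski:
  assumes "pair_graph G"
  shows "pair_graph (mycielski G)"
proof -
  interpret pair_graph G by fact
  have sub: "parcs (mycielski G) \<subseteq> pverts (mycielski G) \<times> pverts (mycielski G)"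
    by (auto simp: mycielski_def dest: in_arcsD1 in_arcsD2)
  have fin: "finite (pverts (mycielski G))"
    by (simp add: mycielski_def pair_finite_verts)
  have "finite (parcs (mycielski G))"
    using finite_subset[OF sub] fin by simp
  moreover have "sym (parcs G)"
    using pair_sym_arcs by (simp add: symmetric_def)
  then have "sym (parcs (mycielski G))"
    by (auto simp: mycielski_def intro!: symI dest: symD)
  moreover have "fst e \<noteq> snd e" if "e \<in> parcs (mycielski G)" for e
    using that by (auto simp: mycielski_def dest: pair_no_loops)
  ultimately show ?thesis
    using sub fin by unfold_locales (auto simp: symmetric_def)
qed

lemma finite_star_matching_cards:
  assumes "pair_graph H"
  shows "finite {card (pverts S) | S. star_matching k S H}"
proof -
  interpret pair_graph H by fact
  have "{card (pverts S) | S. star_matching k S H} \<subseteq> {..card (pverts H)}"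
    by (auto simp: star_matching_def subgraph_def intro!: card_mono pair_finite_verts)
  then show ?thesis
    by (rule finite_subset) simp
qed

lemma star_matching_null:
  assumes "pair_graph H"
  shows "star_matching k \<lparr> pverts = {}, parcs = {} \<rparr> H"
proof -
  interpret pair_graph H by fact
  have "pair_graph \<lparr> pverts = {} :: 'a set, parcs = {} \<rparr>"
    by unfold_locales (auto simp: symmetric_def sym_def)
  moreover from this have "wf_digraph (with_proj \<lparr> pverts = {} :: 'a set, parcs = {} \<rparr>)"
    by unfold_locales auto
  ultimately show ?thesis
    by (auto simp: star_matching_def subgraph_def compatible_def pre_digraph.sccs_def
        induced_subgraph_def strongly_connected_def wf_digraph)
qed

end

theory Submission
  imports Defs
begin

text \<open>
  Let \<open>H\<close> be the complement of \<open>G\<close>, \<open>i\<close> its 4-star deficiency and \<open>p\<close> the path covering number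
  of the complement of the Mycielski graph. We show \<open>p = max 1 (\<lceil>i / 2\<rceil> - 1)\<close>.

  Upper bound: the originals and copies of the vertices of a star with at most four leaves can be
  traversed by a path with both ends among the copies. As the copies form a clique, these paths
  concatenate to a single path \<open>Q\<close>. If \<open>x\<^sub>1, x\<^sub>2, \<dots>\<close> are the unmatched vertices of \<open>H\<close>, with copies
  \<open>x\<^sub>1', x\<^sub>2', \<dots>\<close> and apex \<open>u\<close>, then \<open>x\<^sub>1 x\<^sub>1' Q x\<^sub>2' x\<^sub>2 u x\<^sub>3 x\<^sub>3' x\<^sub>4' x\<^sub>4\<close> is a path, and the remaining
  unmatched vertices are covered in pairs by \<open>x x' y' y\<close>.

  Lower bound: given a cover by \<open>p\<close> paths, all but at most \<open>2 p + 2\<close> originals \<open>v\<close> are neither ends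
  of a path nor next to the apex, so one of their two neighbours on the path is the original or the
  copy of some \<open>f v\<close> adjacent to \<open>v\<close> in \<open>H\<close>. Every vertex has at most four preimages under \<open>f\<close>, and
  such a map always yields a 4-star matching that covers its domain.
\<close>

section \<open>Star matchings as leaf-to-centre maps\<close>

text \<open>\<open>D\<close> is the set of leaves and \<open>g\<close> sends a leaf to the centre of its star; in a star
  \<open>K\<^bsub>1,1\<^esub>\<close> one of the two vertices is chosen as the leaf.\<close>

definition star_assignment :: "nat \<Rightarrow> ('a \<times> 'a) set \<Rightarrow> 'a set \<Rightarrow> ('a \<Rightarrow> 'a) \<Rightarrow> bool" where
  "star_assignment k E D g \<longleftrightarrow> finite D \<and> (\<forall>d\<in>D. (d, g d) \<in> E \<and> g d \<notin> D) \<and>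
     (\<forall>c. card {d \<in> D. g d = c} \<le> k)"

text \<open>The one-vertex side of each component serves as its centre. Since the number of leaves
  \<open>i\<close> is at least 1, no centre is left without a leaf, so leaves and their images
  exhaust \<open>pverts S\<close>.\<close>

lemma star_matching_imp_assignment:
  assumes "star_matching k S H"
  obtains D g where "star_assignment k (parcs H) D g" "D \<union> g ` D = pverts S"
proof -
  have S: "pair_graph S" and sub: "subgraph (with_proj S) (with_proj H)"
    and comp: "\<And>C. C \<in> pre_digraph.sccs (with_proj S) \<Longrightarrow>
      \<exists>i \<in> {1..k}. complete_bipartite_digraph 1 i C"
    using assms by (auto simp: star_matching_def)
  interpret pair_graph S by fact
  have "\<exists>c \<in> T. T - {c} \<noteq> {} \<and> card (T - {c}) \<le> k \<and> (\<forall>w \<in> T - {c}. (w, c) \<in> parcs S)"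
    if T: "T \<in> sccs_verts" for T
  proof -
    have "with_proj S \<restriction> T \<in> sccs"
      using T by (simp add: in_sccs_verts_conv)
    from comp[OF this] obtain i U W where i: "1 \<le> i" "i \<le> k"
      and UW: "T = U \<union> W" "U \<inter> W = {}" "card U = 1" "card W = i"
        "arcs_ends (with_proj S \<restriction> T) = U \<times> W \<union> W \<times> U"
      by (auto simp: complete_bipartite_digraph_def)
    from UW(3) obtain c where c: "U = {c}"
      by (auto simp: card_1_singleton_iff)
    have W: "T - {c} = W"
      using UW c by auto
    have "(w, c) \<in> parcs S" if "w \<in> W" for w
    proof -
      have "(w, c) \<in> arcs_ends (with_proj S \<restriction> T)"
        using UW(5) c that by auto
      then show ?thesis
        by (auto simp: arcs_ends_def arc_to_ends_def)
    qed
    then show ?thesis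
      using UW c W i by (intro bexI[of _ c]) auto
  qed
  then obtain centre where centre: "\<And>T. T \<in> sccs_verts \<Longrightarrow> centre T \<in> T \<and>
      T - {centre T} \<noteq> {} \<and> card (T - {centre T}) \<le> k \<and>
      (\<forall>w \<in> T - {centre T}. (w, centre T) \<in> parcs S)"
    by metis
  \<comment> \<open>Within \<open>pverts S\<close> the fixed points of \<open>g\<close> are exactly
    the centres, which makes \<open>D\<close> the set of leaves.\<close>
  define g where "g u = centre (scc_of u)" for u
  define D where "D = {u \<in> pverts S. g u \<noteq> u}"
  have scc: "scc_of u \<in> sccs_verts" "u \<in> scc_of u" if "u \<in> pverts S" for u
    using that scc_of_in_sccs_verts[of u] by (auto intro: in_scc_of_self)
  have sub_verts: "scc_of u \<subseteq> pverts S" if "u \<in> pverts S" for u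
    using sccs_verts_subsets[OF scc(1)[OF that]] by simp
  have scc_eq: "scc_of v = scc_of u" if "u \<in> pverts S" "v \<in> scc_of u" for u v
    using that scc[of u] scc[of v] sub_verts[of u] sccs_verts_disjoint[of "scc_of u" "scc_of v"]
    by blast
  have g_in: "g u \<in> scc_of u" if "u \<in> pverts S" for u
    using centre[OF scc(1)[OF that]] by (simp add: g_def)
  have gg: "g (g u) = g u" if "u \<in> pverts S" for u
    using scc_eq[OF that g_in[OF that]] by (simp add: g_def)
  have fin: "finite D"
    by (simp add: D_def pair_finite_verts)
  have "star_assignment k (parcs H) D g"
    unfolding star_assignment_def
  proof (intro conjI ballI allI)
    fix d assume d: "d \<in> D"
    then have "d \<in> scc_of d - {g d}"
      using scc by (auto simp: D_def)
    then have "(d, g d) \<in> parcs S"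
      using centre[OF scc(1), of d] d by (auto simp: D_def g_def)
    then show "(d, g d) \<in> parcs H"
      using sub by (auto simp: subgraph_def)
    show "g d \<notin> D"
      using gg d by (auto simp: D_def)
  next
    fix c
    show "card {d \<in> D. g d = c} \<le> k"
    proof (cases "{d \<in> D. g d = c} = {}")
      case False
      then obtain d0 where d0: "d0 \<in> D" "g d0 = c"
        by auto
      then have d0': "d0 \<in> pverts S"
        by (simp add: D_def)
      have c: "c \<in> pverts S" "scc_of c = scc_of d0"
        using g_in[OF d0'] d0 sub_verts[OF d0'] scc_eq[OF d0'] by auto
      have "{d \<in> D. g d = c} \<subseteq> scc_of c - {centre (scc_of c)}"
      proof
        fix d assume "d \<in> {d \<in> D. g d = c}"
        then have d: "d \<in> pverts S" "g d = c" "d \<noteq> c"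
          by (auto simp: D_def)
        then have "scc_of c = scc_of d"
          using scc_eq[OF d(1)] g_in[OF d(1)] by simp
        then show "d \<in> scc_of c - {centre (scc_of c)}"
          using d scc by (auto simp: g_def)
      qed
      moreover have "finite (scc_of c)"
        using finite_subset[OF sub_verts[OF c(1)]] by (simp add: pair_finite_verts)
      ultimately have "card {d \<in> D. g d = c} \<le> card (scc_of c - {centre (scc_of c)})"
        by (intro card_mono) auto
      also have "\<dots> \<le> k"
        using centre[OF scc(1)[OF c(1)]] by blast
      finally show ?thesis .
    next
      case True
      show ?thesis
        unfolding True by simp
    qed
  qed (fact fin)
  moreover have "D \<union> g ` D = pverts S"
  proof (intro equalityI subsetI)
    fix x assume "x \<in> D \<union> g ` D"
    then show "x \<in> pverts S"
      using g_in sub_verts by (auto simp: D_def)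
  next
    fix x assume x: "x \<in> pverts S"
    show "x \<in> D \<union> g ` D"
    proof (cases "x \<in> D")
      case False
      then have gx: "x = centre (scc_of x)"
        using x by (simp add: D_def g_def)
      obtain w where w: "w \<in> scc_of x" "w \<noteq> x"
        using centre[OF scc(1)[OF x]] gx by auto
      then have "g w = x" "w \<in> pverts S"
        using scc_eq[OF x, of w] sub_verts[OF x] gx by (auto simp: g_def)
      then show ?thesis
        using w by (auto simp: D_def)
    qed simp
  qed
  ultimately show thesis
    by (rule that)
qed

text \<open>The arcs between leaves and centres, taken in both directions, form the matching. The
  map \<open>h\<close>, which sends leaves to centres and fixes centres, is constant along these
  arcs, and every vertex is joined to its image; hence the components are the fibres of
  \<open>h\<close>.\<close>

lemma assignment_imp_star_matching:
  assumes H: "pair_graph H" and sa: "star_assignment k (parcs H) D g"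
  obtains S where "star_matching k S H" "pverts S = D \<union> g ` D"
proof -
  interpret H: pair_graph H by fact
  define S where "S = \<lparr> pverts = D \<union> g ` D,
    parcs = {(d, g d) | d. d \<in> D} \<union> {(g d, d) | d. d \<in> D} \<rparr>"
  have fin: "finite D" and arc: "\<And>d. d \<in> D \<Longrightarrow> (d, g d) \<in> parcs H"
    and centre: "\<And>d. d \<in> D \<Longrightarrow> g d \<notin> D" and fibre: "\<And>c. card {d \<in> D. g d = c} \<le> k"
    using sa by (auto simp: star_assignment_def)
  have "sym (parcs H)"
    using H.pair_sym_arcs by (simp add: symmetric_def)
  then have arc': "(g d, d) \<in> parcs H" if "d \<in> D" for d
    using arc[OF that] by (auto dest: symD)
  have S: "pair_graph S"
  proof
    have "parcs S = (\<lambda>d. (d, g d)) ` D \<union> (\<lambda>d. (g d, d)) ` D"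
      by (auto simp: S_def)
    then show "finite (parcs S)"
      using fin by simp
    show "symmetric (with_proj S)"
      by (auto simp: S_def symmetric_def intro!: symI)
    fix e assume "e \<in> parcs S"
    then show "fst e \<noteq> snd e"
      using centre by (auto simp: S_def) metis+
  qed (use fin in \<open>auto simp: S_def\<close>)
  interpret S: pair_graph S by fact
  have "pverts S \<subseteq> pverts H" "parcs S \<subseteq> parcs H"
    using arc arc' H.in_arcsD1 H.in_arcsD2 by (auto simp: S_def)
  then have sub: "subgraph (with_proj S) (with_proj H)"
    using H.wf_digraph S.wf_digraph by (auto simp: subgraph_def compatible_def)
  define h where "h x = (if x \<in> D then g x else x)" for x
  have "h x = h y" if "x \<rightarrow>\<^sup>*\<^bsub>with_proj S\<^esub> y" for x y
    using that
  proof (induction rule: S.reachable_induct)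
    case (step y z)
    then show ?case
      using centre by (auto simp: S_def h_def)
  qed simp
  moreover have to_centre: "x \<rightarrow>\<^sup>*\<^bsub>with_proj S\<^esub> h x" "h x \<rightarrow>\<^sup>*\<^bsub>with_proj S\<^esub> x" if "x \<in> pverts S" for x
  proof -
    have "x = h x \<or> (x, h x) \<in> parcs S \<and> (h x, x) \<in> parcs S"
      by (auto simp: h_def S_def)
    then show "x \<rightarrow>\<^sup>*\<^bsub>with_proj S\<^esub> h x" "h x \<rightarrow>\<^sup>*\<^bsub>with_proj S\<^esub> x"
      using that by (auto intro: S.reachable_adjI)
  qed
  ultimately have scc: "S.scc_of u = {x \<in> pverts S. h x = h u}" if "u \<in> pverts S" for u
    using that S.reachable_in_verts
    unfolding S.scc_of_def by (auto; metis S.reachable_trans)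
  have "\<exists>i \<in> {1..k}. complete_bipartite_digraph 1 i C" if "C \<in> S.sccs" for C
  proof -
    from that obtain u where u: "u \<in> pverts S" "C = with_proj S \<restriction> S.scc_of u"
      by (auto simp: S.sccs_conv_sccs_verts S.sccs_verts_conv_scc_of)
    define c L where "c = h u" and "L = {d \<in> D. g d = c}"
    have c: "c \<in> pverts S" "c \<notin> D"
      using u centre by (auto simp: c_def h_def S_def)
    then have L: "c \<notin> L" "L \<noteq> {}" "finite L"
      using fin by (auto simp: L_def S_def)
    have T: "S.scc_of u = {c} \<union> L"
      unfolding scc[OF u(1)] c_def[symmetric] using c by (auto simp: L_def h_def S_def)
    have "C = with_proj \<lparr> pverts = {c} \<union> L, parcs = {c} \<times> L \<union> L \<times> {c} \<rparr>"
      unfolding u(2) T using c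
      by (auto simp: induce_subgraph_def with_proj_def S_def L_def)
    moreover have "complete_bipartite_digraph 1 (card L)
        (with_proj \<lparr> pverts = {c} \<union> L, parcs = {c} \<times> L \<union> L \<times> {c} \<rparr>)"
      unfolding complete_bipartite_digraph_pair_def using L
      by (intro conjI exI[of _ "{c}"] exI[of _ L]) auto
    moreover have "card L \<in> {1..k}"
      using L fibre[of c] by (auto simp: L_def Suc_le_eq card_gt_0_iff)
    ultimately show ?thesis
      by auto
  qed
  then have "star_matching k S H"
    using S sub by (simp add: star_matching_def)
  then show thesis
    by (rule that) (simp add: S_def)
qed

text \<open>
  If a vertex \<open>l\<close> outside the image of \<open>f\<close> is sent to \<open>f l \<in> A\<close>, then \<open>f l\<close> can be dropped from \<open>A\<close>: the
  only edge available to cover \<open>l\<close> also covers \<open>f l\<close>. This is why the induction records that only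
  edges \<open>{v, f v}\<close> are used. Otherwise \<open>f\<close> permutes \<open>A \<inter> f ` A\<close> and maps the rest of \<open>A\<close> outside \<open>A\<close>,
  and a minimal edge cover of the cycles of \<open>f\<close> consists of stars with one or two leaves.
\<close>

lemma bounded_map_imp_star_assignment:
  assumes k: "2 \<le> k" and E: "sym E"
  shows "finite A \<Longrightarrow> (\<And>v. v \<in> A \<Longrightarrow> (v, f v) \<in> E \<and> f v \<noteq> v) \<Longrightarrow>
    (\<And>c. card {v \<in> A. f v = c} \<le> k) \<Longrightarrow>
    \<exists>D g. star_assignment k E D g \<and> A \<subseteq> D \<union> g ` D \<and>
      (\<forall>d \<in> D. d \<in> A \<and> g d = f d \<or> g d \<in> A \<and> f (g d) = d)"
proof (induction A rule: finite_psubset_induct)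
  case (psubset A)
  note fin = \<open>finite A\<close>
  show ?case
  proof (cases "\<exists>l \<in> A. l \<notin> f ` A \<and> f l \<in> A")
    case True
    then obtain l where l: "l \<in> A" "l \<notin> f ` A" "f l \<in> A"
      by auto
    have ne: "f l \<noteq> l"
      using psubset.prems(1) l(1) by auto
    have "card {v \<in> A - {f l}. f v = c} \<le> k" for c
      using card_mono[of "{v \<in> A. f v = c}" "{v \<in> A - {f l}. f v = c}"] fin psubset.prems(2)[of c]
      by (simp add: subset_eq)
    then obtain D g where D: "star_assignment k E D g" "A - {f l} \<subseteq> D \<union> g ` D"
      and g: "\<forall>d \<in> D. d \<in> A - {f l} \<and> g d = f d \<or> g d \<in> A - {f l} \<and> f (g d) = d"
      using psubset.IH[of "A - {f l}"] psubset.prems(1) l by blast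
    have "l \<in> D \<union> g ` D"
      using D(2) l ne by blast
    then have "f l \<in> D \<union> g ` D"
    proof
      assume "l \<in> D"
      then have "g l = f l"
        using g l(2) by force
      then show ?thesis
        using \<open>l \<in> D\<close> by force
    next
      assume "l \<in> g ` D"
      then obtain d where d: "d \<in> D" "l = g d"
        by auto
      then have "f l = d"
        using g l(2) by force
      then show ?thesis
        using d by simp
    qed
    then have "A \<subseteq> D \<union> g ` D"
      using D(2) by blast
    then show ?thesis
      using D(1) g by blast
  next
    case False
    define L where "L = A - f ` A"
    define C where "C = A \<inter> f ` A"
    have finC: "finite C"
      using fin by (simp add: C_def)
    have fL: "f l \<notin> A" if "l \<in> L" for l
      using False that by (auto simp: L_def)
    \<comment> \<open>A preimage in \<open>A\<close> of an element of \<open>C\<close> cannot lie in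
      \<open>L\<close>, because \<open>f\<close> sends \<open>L\<close> outside \<open>A\<close>. By
      finiteness the inclusion becomes an equality, so \<open>f\<close> permutes
      \<open>C\<close>.\<close>
    have sub: "C \<subseteq> f ` C"
      using fL by (auto simp: C_def L_def)
    then have fC: "f ` C = C"
      using finC card_image_le[OF finC, of f] card_seteq[of "f ` C" C] by auto
    then have inj: "inj_on f C"
      using finC by (simp add: eq_card_imp_inj_on)
    \<comment> \<open>\<open>M\<close> is a minimal edge cover of the cycles, where the edge from
      \<open>v\<close> to \<open>f v\<close> is represented by \<open>v\<close>.\<close>
    have "\<exists>M \<in> {M. M \<subseteq> C \<and> C \<subseteq> M \<union> f ` M}. \<forall>N \<in> {M. M \<subseteq> C \<and> C \<subseteq> M \<union> f ` M}. N \<subseteq> M \<longrightarrow> M = N"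
      by (rule finite_has_minimal) (use finC in auto)
    then obtain M where M: "M \<subseteq> C" "C \<subseteq> M \<union> f ` M"
      and min: "\<And>N. N \<subseteq> M \<Longrightarrow> C \<subseteq> N \<union> f ` N \<Longrightarrow> M = N"
      by (smt (verit) mem_Collect_eq subset_trans)
    have ne: "f v \<noteq> v" if "v \<in> A" for v
      using psubset.prems(1) that by auto
    \<comment> \<open>Of three consecutive chosen edges the middle one would be redundant, against
      minimality.\<close>
    have M_private: "f v \<notin> M" if v: "v \<in> M" "v \<in> f ` M" for v
    proof
      assume fv: "f v \<in> M"
      obtain u where u: "u \<in> M" "v = f u"
        using v by auto
      have "v \<in> A" "u \<in> A"
        using v u M by (auto simp: C_def)
      then have "C \<subseteq> (M - {v}) \<union> f ` (M - {v})"
        using M(2) u fv ne[of v] ne[of u] by auto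
      from min[OF _ this] v show False
        by auto
    qed
    \<comment> \<open>\<open>R\<close> contains the middle vertices of two consecutive chosen edges;
      these become centres. The first of two such edges, or an isolated edge, has its leaf at
      \<open>v\<close> and its centre at \<open>f v\<close>. The second edge is reversed: its leaf
      is \<open>f v\<close>, and \<open>inv_into\<close> recovers the centre
      \<open>v\<close>.\<close>
    define R where "R = M \<inter> f ` M"
    define D where "D = L \<union> (M - f ` M) \<union> f ` R"
    define g where "g d = (if d \<in> f ` R then inv_into C f d else f d)" for d
    have R: "R \<subseteq> C" "R \<subseteq> M"
      using M by (auto simp: R_def)
    have MA: "M \<subseteq> A" "f ` M \<subseteq> C"
      using M(1) image_mono[OF M(1), of f] fC by (auto simp: C_def)
    have g_R: "g (f v) = v" if "v \<in> R" for v
      using that R inj by (auto simp: g_def intro: inv_into_f_f)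
    have g_L: "g d = f d" if "d \<in> L" for d
      using that MA R by (auto simp: g_def L_def C_def)
    have g_M: "g d = f d" if "d \<in> M - f ` M" for d
      using that R by (auto simp: g_def)
    have cases_D: "d \<in> L \<and> g d = f d \<or> d \<in> M \<and> d \<notin> f ` M \<and> g d = f d \<or>
        (\<exists>v \<in> R. d = f v \<and> g d = v)" if "d \<in> D" for d
      using that unfolding D_def
    proof (elim UnE imageE)
      assume "d \<in> L"
      then show ?thesis
        using g_L[of d] by simp
    next
      assume "d \<in> M - f ` M"
      then show ?thesis
        using g_M[of d] by simp
    next
      fix v assume "d = f v" "v \<in> R"
      then show ?thesis
        using g_R[of v] by simp
    qed
    have orient: "d \<in> A \<and> g d = f d \<or> g d \<in> A \<and> f (g d) = d" if "d \<in> D" for d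
      using cases_D[OF that] MA R by (auto simp: L_def)
    have "f ` R \<subseteq> A"
      using MA(2) R(2) by (auto simp: C_def)
    then have DA: "D \<subseteq> A"
      using MA(1) by (auto simp: D_def L_def)
    have centre: "g d \<notin> D" if d: "d \<in> D" for d
      using cases_D[OF d]
    proof (elim disjE bexE conjE)
      assume "d \<in> L" "g d = f d"
      then show ?thesis
        using fL[of d] DA by auto
    next
      assume dM: "d \<in> M" "d \<notin> f ` M" "g d = f d"
      have "f d \<notin> f ` R"
        using inj_onD[OF inj] dM M R by (auto simp: R_def)
      then show ?thesis
        using dM MA by (auto simp: D_def L_def)
    next
      fix v assume v: "v \<in> R" "d = f v" "g d = v"
      have "v \<notin> f ` R"
        using v M_private by (auto simp: R_def)
      then show ?thesis
        using v by (auto simp: D_def R_def L_def C_def dest: M(1)[THEN subsetD])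
    qed
    have arc: "(d, g d) \<in> E" if "d \<in> D" for d
      using orient[OF that] psubset.prems(1) E by (metis symD)
    have finD: "finite D"
      using fin finC finite_subset[OF M(1)] by (auto simp: D_def L_def R_def)
    have fibre: "card {d \<in> D. g d = c} \<le> k" for c
    proof (cases "c \<in> A")
      case False
      have "{d \<in> D. g d = c} \<subseteq> {v \<in> A. f v = c}"
      proof
        fix d assume "d \<in> {d \<in> D. g d = c}"
        then show "d \<in> {v \<in> A. f v = c}"
          using orient[of d] False by auto
      qed
      then show ?thesis
        using card_mono[of "{v \<in> A. f v = c}" "{d \<in> D. g d = c}"] fin psubset.prems(2)[of c] by simp
    next
      \<comment> \<open>A centre inside \<open>A\<close> can have only its predecessor and its
        successor on the cycle as leaves, so \<open>2 \<le> k\<close> is enough here.\<close>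
      case True
      have "{d \<in> D. g d = c} \<subseteq> {v \<in> C. f v = c} \<union> {f c}"
      proof
        fix d assume "d \<in> {d \<in> D. g d = c}"
        then show "d \<in> {v \<in> C. f v = c} \<union> {f c}"
          using cases_D[of d] fL[of d] True M(1) by auto
      qed
      moreover have "card {v \<in> C. f v = c} \<le> 1"
        using inj finC by (auto simp: card_le_Suc0_iff_eq dest: inj_onD)
      then have "card ({v \<in> C. f v = c} \<union> {f c}) \<le> 2"
        using card_Un_le[of "{v \<in> C. f v = c}" "{f c}"] by simp
      ultimately show ?thesis
        using k finC card_mono[of "{v \<in> C. f v = c} \<union> {f c}" "{d \<in> D. g d = c}"] by simp
    qed
    have "v \<in> D \<union> g ` D" "f v \<in> D \<union> g ` D" if "v \<in> M" for v
    proof -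
      have "v \<in> D \<and> g v = f v \<or> f v \<in> D \<and> g (f v) = v"
        using that g_R g_M by (cases "v \<in> R") (auto simp: D_def R_def)
      then show "v \<in> D \<union> g ` D" "f v \<in> D \<union> g ` D"
        by (metis UnI1 UnI2 imageI)+
    qed
    then have "M \<subseteq> D \<union> g ` D" "f ` M \<subseteq> D \<union> g ` D"
      by auto
    then have "C \<subseteq> D \<union> g ` D"
      using M(2) by blast
    moreover have "A = L \<union> C" "L \<subseteq> D"
      by (auto simp: L_def C_def D_def)
    ultimately have "A \<subseteq> D \<union> g ` D"
      by blast
    moreover have "star_assignment k E D g"
      using finD arc centre fibre by (auto simp: star_assignment_def)
    ultimately show ?thesis
      using orient by blast
  qed
qed

section \<open>From path covers to star matchings\<close>

lemma vwalk_arcs_conv_zip: "vwalk_arcs p = zip p (tl p)"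
  by (induction p rule: vwalk_arcs.induct) auto

lemma set_vwalk_arcs: "set (vwalk_arcs p) = {(p ! i, p ! Suc i) | i. Suc i < length p}"
  by (force simp: vwalk_arcs_conv_zip set_zip nth_tl)

lemma vwalk_arcs_subset_iff:
  "set (vwalk_arcs p) \<subseteq> R \<longleftrightarrow> successively (\<lambda>x y. (x, y) \<in> R) p"
  by (induction p rule: vwalk_arcs.induct) auto

lemma arcs_ends_with_proj: "arcs_ends (with_proj H) = parcs H"
  by (auto simp: arcs_ends_def arc_to_ends_def)

lemma vpath_with_proj_iff:
  "vpath p (with_proj H) \<longleftrightarrow>
     p \<noteq> [] \<and> distinct p \<and> set p \<subseteq> pverts H \<and> successively (\<lambda>x y. (x, y) \<in> parcs H) p"
  by (auto simp: vpath_def vwalk_def arcs_ends_with_proj vwalk_arcs_subset_iff)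

text \<open>Arcs keep the direction in which the lists traverse them, so that predecessor and
  successor of a vertex can be treated separately.\<close>

definition cover_arcs :: "'a list set \<Rightarrow> ('a \<times> 'a) set" where
  "cover_arcs P = (\<Union>p \<in> P. set (vwalk_arcs p))"

context
  fixes P :: "'a list set" and H :: "'a pair_pre_digraph"
  assumes P: "path_cover P H"
begin

lemma cover_arcs_subset: "cover_arcs P \<subseteq> parcs H"
  using P by (auto simp: path_cover_def cover_arcs_def vpath_def vwalk_def arcs_ends_with_proj)

lemma cover_arcsE:
  assumes "(x, y) \<in> cover_arcs P"
  obtains p i where "p \<in> P" "distinct p" "Suc i < length p" "x = p ! i" "y = p ! Suc i"
  using assms P by (auto simp: cover_arcs_def set_vwalk_arcs path_cover_def vpath_def)

text \<open>Disjointness of the paths and distinctness of each list give every vertex a single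
  position in the cover; uniqueness of successors and predecessors follows from this.\<close>

lemma cover_path_unique:
  assumes "p \<in> P" "q \<in> P" "i < length p" "j < length q" "p ! i = q ! j"
  shows "p = q" "i = j"
proof -
  have "p ! i \<in> set p \<inter> set q"
    using assms by (metis IntI nth_mem)
  then show "p = q"
    using assms P by (fastforce simp: path_cover_def)
  then show "i = j"
    using assms P by (auto simp: path_cover_def vpath_def nth_eq_iff_index_eq)
qed

lemma cover_arcs_out_unique: "(x, y) \<in> cover_arcs P \<Longrightarrow> (x, z) \<in> cover_arcs P \<Longrightarrow> y = z"
  using cover_path_unique by (elim cover_arcsE) (metis Suc_lessD)

lemma cover_arcs_in_unique: "(y, x) \<in> cover_arcs P \<Longrightarrow> (z, x) \<in> cover_arcs P \<Longrightarrow> y = z"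
  using cover_path_unique by (elim cover_arcsE) (metis Suc_inject)

text \<open>Ensures that the predecessor and the successor of a vertex are different.\<close>

lemma cover_arcs_asym:
  assumes "(x, y) \<in> cover_arcs P"
  shows "(y, x) \<notin> cover_arcs P"
proof
  assume "(y, x) \<in> cover_arcs P"
  then obtain q j where q: "q \<in> P" "Suc j < length q" "y = q ! j" "x = q ! Suc j"
    by (rule cover_arcsE)
  obtain p i where p: "p \<in> P" "Suc i < length p" "x = p ! i" "y = p ! Suc i"
    using assms by (rule cover_arcsE)
  have "Suc i = j" "p = q"
    using cover_path_unique[of p q "Suc i" j] p q by auto
  moreover have "i = Suc j"
    using cover_path_unique[of p q i "Suc j"] p q by auto
  ultimately show False
    by simp
qed

lemma cover_arcs_domain:
  assumes "x \<in> pverts H" "x \<notin> last ` P"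
  obtains y where "(x, y) \<in> cover_arcs P"
proof -
  obtain p where p: "p \<in> P" "x \<in> set p"
    using assms P unfolding path_cover_def by blast
  then obtain i where i: "i < length p" "x = p ! i"
    by (auto simp: in_set_conv_nth)
  have "Suc i < length p"
  proof (rule ccontr)
    assume "\<not> Suc i < length p"
    then have "i = length p - 1" "p \<noteq> []"
      using i by auto
    then have "x = last p"
      using i by (simp add: last_conv_nth)
    then show False
      using assms p by auto
  qed
  then have "(x, p ! Suc i) \<in> cover_arcs P"
    using p i by (auto simp: cover_arcs_def set_vwalk_arcs)
  then show thesis
    by (rule that)
qed

lemma cover_arcs_range:
  assumes "x \<in> pverts H" "x \<notin> hd ` P"
  obtains y where "(y, x) \<in> cover_arcs P"
proof -
  obtain p where p: "p \<in> P" "x \<in> set p"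
    using assms P unfolding path_cover_def by blast
  then obtain i where i: "i < length p" "x = p ! i"
    by (auto simp: in_set_conv_nth)
  have "i \<noteq> 0"
    using assms p i by (metis hd_conv_nth imageI list.size(3) not_less0)
  then have "Suc (i - 1) < length p" "p ! Suc (i - 1) = x"
    using i by auto
  then have "(p ! (i - 1), x) \<in> cover_arcs P"
    using p unfolding cover_arcs_def set_vwalk_arcs by blast
  then show thesis
    by (rule that)
qed

end

section \<open>Adjacency in the complement of the Mycielski graph\<close>

text \<open>An original is adjacent to its own copy because \<open>G\<close> has no loops. Symmetry
  of \<open>G\<close> is needed for the arcs leaving a copy, which \<open>mycielski\<close> derives
  from the reversed arcs of \<open>G\<close>.\<close>

lemma mycielski_complement_arcs:
  assumes "pair_graph G"
  shows "(Orig v, Orig w) \<in> parcs (complement (mycielski G)) \<longleftrightarrow> (v, w) \<in> parcs (complement G)"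
    and "(Orig v, Copy w) \<in> parcs (complement (mycielski G)) \<longleftrightarrow>
      v \<in> pverts G \<and> w = v \<or> (v, w) \<in> parcs (complement G)"
    and "(Copy v, Orig w) \<in> parcs (complement (mycielski G)) \<longleftrightarrow>
      v \<in> pverts G \<and> w = v \<or> (v, w) \<in> parcs (complement G)"
    and "(Copy v, Copy w) \<in> parcs (complement (mycielski G)) \<longleftrightarrow>
      v \<in> pverts G \<and> w \<in> pverts G \<and> v \<noteq> w"
    and "(Orig v, Apex) \<in> parcs (complement (mycielski G)) \<longleftrightarrow> v \<in> pverts G"
    and "(Apex, Orig v) \<in> parcs (complement (mycielski G)) \<longleftrightarrow> v \<in> pverts G"
    and "(Copy v, Apex) \<notin> parcs (complement (mycielski G))"
    and "(Apex, Copy v) \<notin> parcs (complement (mycielski G))"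
    and "(Apex, Apex) \<notin> parcs (complement (mycielski G))"
proof -
  interpret pair_graph G by fact
  have "sym (parcs G)"
    using pair_sym_arcs by (simp add: symmetric_def)
  then have *: "(v, w) \<in> parcs G \<longleftrightarrow> (w, v) \<in> parcs G" for v w
    by (auto dest: symD)
  have "(v, v) \<notin> parcs G" for v
    using pair_no_loops by force
  then show "(Copy v, Orig w) \<in> parcs (complement (mycielski G)) \<longleftrightarrow>
      v \<in> pverts G \<and> w = v \<or> (v, w) \<in> parcs (complement G)"
    "(Orig v, Copy w) \<in> parcs (complement (mycielski G)) \<longleftrightarrow>
      v \<in> pverts G \<and> w = v \<or> (v, w) \<in> parcs (complement G)"
    using * by (auto simp: complement_def mycielski_def)
qed (auto simp: complement_def mycielski_def)

lemma pverts_complement_mycielski: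
  "pverts (complement (mycielski G)) = Orig ` pverts G \<union> Copy ` pverts G \<union> {Apex}"
  by (simp add: complement_def mycielski_def)

lemma card_le_1I:
  assumes "\<And>x y. x \<in> A \<Longrightarrow> y \<in> A \<Longrightarrow> x = y"
  shows "card A \<le> 1"
  using assms by (cases "finite A") (auto simp: card_le_Suc0_iff_eq)

lemma path_cover_imp_star_assignment:
  assumes G: "pair_graph G" and P: "path_cover P (complement (mycielski G))"
  obtains D g where "star_assignment 4 (parcs (complement G)) D g"
    "card (pverts G) \<le> card (D \<union> g ` D) + 2 * card P + 2"
proof -
  interpret G: pair_graph G by fact
  interpret H: pair_graph "complement G"
    by (rule pair_graph_complement) fact
  have symH: "sym (parcs (complement G))"
    using H.pair_sym_arcs by (simp add: symmetric_def)
  note arcs = mycielski_complement_arcs[OF G]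
  let ?N = "cover_arcs P"
  have finP: "finite P"
    using P by (simp add: path_cover_def)
  have N: "(x, y) \<in> parcs (complement (mycielski G))" if "(x, y) \<in> ?N" for x y
    using that cover_arcs_subset[OF P] by blast
  define linked where "linked x v \<longleftrightarrow> (x, Orig v) \<in> ?N \<or> (Orig v, x) \<in> ?N" for x v
  \<comment> \<open>Choosing a witness \<open>w\<close> for each \<open>v\<close> in
    \<open>A\<close> gives the map \<open>f\<close> to which
    \<open>bounded_map_imp_star_assignment\<close> is applied.\<close>
  define A where "A = {v \<in> pverts G. \<exists>w. (v, w) \<in> parcs (complement G) \<and>
    (linked (Orig w) v \<or> linked (Copy w) v)}"
  have "\<forall>v \<in> A. \<exists>w. (v, w) \<in> parcs (complement G) \<and> (linked (Orig w) v \<or> linked (Copy w) v)"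
    by (auto simp: A_def)
  then obtain f where f: "\<And>v. v \<in> A \<Longrightarrow> (v, f v) \<in> parcs (complement G)"
      "\<And>v. v \<in> A \<Longrightarrow> linked (Orig (f v)) v \<or> linked (Copy (f v)) v"
    by metis
  have finA: "finite A"
    by (simp add: A_def)
  have linked: "finite {v. linked x v}" "card {v. linked x v} \<le> 2" for x
  proof -
    have "{v. linked x v} = {v. (x, Orig v) \<in> ?N} \<union> {v. (Orig v, x) \<in> ?N}"
      by (auto simp: linked_def)
    moreover have "card {v. (x, Orig v) \<in> ?N} \<le> 1" "card {v. (Orig v, x) \<in> ?N} \<le> 1"
      by (intro card_le_1I; auto dest: cover_arcs_out_unique[OF P] cover_arcs_in_unique[OF P])+
    ultimately show "card {v. linked x v} \<le> 2"
      using card_Un_le[of "{v. (x, Orig v) \<in> ?N}" "{v. (Orig v, x) \<in> ?N}"] by simp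
    have "Orig v \<in> pverts (mycielski G)" if "linked x v" for v
      using N that by (auto simp: linked_def complement_def)
    then have "{v. linked x v} \<subseteq> pverts G"
      by (auto simp: mycielski_def)
    then show "finite {v. linked x v}"
      by (rule finite_subset) simp
  qed
  \<comment> \<open>The bound 4 arises because a preimage of \<open>c\<close> is next to
    \<open>Orig c\<close> or \<open>Copy c\<close> on a path, and each of these has at most two
    neighbours there.\<close>
  have fibre: "card {v \<in> A. f v = c} \<le> 4" for c
  proof -
    have "{v \<in> A. f v = c} \<subseteq> {v. linked (Orig c) v} \<union> {v. linked (Copy c) v}"
      using f(2) by auto
    then have "card {v \<in> A. f v = c} \<le> card ({v. linked (Orig c) v} \<union> {v. linked (Copy c) v})"
      using linked by (intro card_mono) auto
    also have "\<dots> \<le> card {v. linked (Orig c) v} + card {v. linked (Copy c) v}"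
      by (rule card_Un_le)
    finally show ?thesis
      using linked(2)[of "Orig c"] linked(2)[of "Copy c"] by simp
  qed
  have ne: "f v \<noteq> v" if "v \<in> A" for v
    using f(1)[OF that] by (auto simp: complement_def)
  obtain D g where Dg: "star_assignment 4 (parcs (complement G)) D g" "A \<subseteq> D \<union> g ` D"
    using bounded_map_imp_star_assignment[OF _ symH finA, of 4 f] f(1) ne fibre by auto
  \<comment> \<open>The three sets account for the loss: at most \<open>card P\<close> first
    vertices, \<open>card P\<close> last vertices, and two neighbours of the apex.\<close>
  have missed: "pverts G - A \<subseteq> Orig -` (hd ` P) \<union> Orig -` (last ` P) \<union> {v. linked Apex v}"
  proof
    fix v assume v: "v \<in> pverts G - A"
    show "v \<in> Orig -` (hd ` P) \<union> Orig -` (last ` P) \<union> {v. linked Apex v}"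
    proof (rule ccontr)
      assume not: "\<not> ?thesis"
      have "Orig v \<in> pverts (complement (mycielski G))"
        using v by (simp add: pverts_complement_mycielski)
      moreover have "Orig v \<notin> hd ` P" "Orig v \<notin> last ` P"
        using not by blast+
      ultimately obtain a b where ab: "(a, Orig v) \<in> ?N" "(Orig v, b) \<in> ?N"
        by (metis cover_arcs_domain[OF P] cover_arcs_range[OF P])
      have "a \<noteq> b"
        using ab cover_arcs_asym[OF P] by blast
      \<comment> \<open>Any other neighbour on the path would put \<open>v\<close> into
        \<open>A\<close>. As \<open>a\<close> and \<open>b\<close> differ, they cannot both be
        \<open>Copy v\<close>, so one of them is the apex.\<close>
      have "x = Copy v \<or> x = Apex" if x: "linked x v" for x
      proof (cases x)
        case (Orig w)
        then have "(v, w) \<in> parcs (complement G)"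
          using x by (auto simp: linked_def arcs dest!: N dest: symD[OF symH])
        then show ?thesis
          using x v Orig by (auto simp: A_def)
      next
        case (Copy w)
        then have "w = v \<or> (v, w) \<in> parcs (complement G)"
          using x by (auto simp: linked_def arcs dest!: N dest: symD[OF symH])
        then show ?thesis
          using x v Copy by (auto simp: A_def)
      qed simp
      then have "a = Copy v \<or> a = Apex" "b = Copy v \<or> b = Apex"
        using ab by (auto simp: linked_def)
      then have "linked Apex v"
        using ab \<open>a \<noteq> b\<close> by (auto simp: linked_def)
      then show False
        using not by simp
    qed
  qed
  have vimage: "finite (Orig -` (h ` P))" "card (Orig -` (h ` P)) \<le> card P" for h :: "_ \<Rightarrow> 'a mycielski_vertex"
  proof -
    have inj: "inj Orig"
      by (auto intro: injI)
    show "finite (Orig -` (h ` P))"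
      using finP inj by (intro finite_vimageI) auto
    have "card (Orig -` (h ` P)) = card (Orig ` (Orig -` (h ` P)))"
      using inj by (intro card_image[symmetric]) (auto intro: inj_on_subset)
    also have "\<dots> \<le> card (h ` P)"
      using finP by (intro card_mono) auto
    also have "\<dots> \<le> card P"
      using finP by (rule card_image_le)
    finally show "card (Orig -` (h ` P)) \<le> card P" .
  qed
  have "card (pverts G - A) \<le> card (Orig -` (hd ` P) \<union> Orig -` (last ` P) \<union> {v. linked Apex v})"
    using missed vimage linked by (intro card_mono) auto
  also have "\<dots> \<le> card (Orig -` (hd ` P)) + card (Orig -` (last ` P)) + card {v. linked Apex v}"
    by (meson add_le_mono1 card_Un_le order_trans)
  also have "\<dots> \<le> 2 * card P + 2"
    using vimage(2)[of hd] vimage(2)[of last] linked(2)[of Apex] by linarith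
  finally have "card (pverts G - A) \<le> 2 * card P + 2" .
  moreover have "card (pverts G) = card A + card (pverts G - A)"
    using card_Un_disjoint[of A "pverts G - A"] finA by (auto simp: A_def Un_absorb1)
  moreover have "card A \<le> card (D \<union> g ` D)"
    using Dg by (intro card_mono) (auto simp: star_assignment_def)
  ultimately show thesis
    using that[OF Dg(1)] by linarith
qed

section \<open>From star matchings to path covers\<close>

definition copy_ended_path ::
    "'a pair_pre_digraph \<Rightarrow> 'a set \<Rightarrow> 'a mycielski_vertex list \<Rightarrow> bool" where
  "copy_ended_path G W q \<longleftrightarrow> distinct q \<and> set q = Orig ` W \<union> Copy ` W \<and>
     successively (\<lambda>x y. (x, y) \<in> parcs (complement (mycielski G))) q \<and>
     (q \<noteq> [] \<longrightarrow> hd q \<in> Copy ` W \<and> last q \<in> Copy ` W)"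

text \<open>The connecting arc joins copies of two different vertices, since \<open>W\<close> and
  \<open>X\<close> are disjoint, and such copies are always adjacent.\<close>

lemma copy_ended_path_append:
  assumes G: "pair_graph G" and W: "W \<subseteq> pverts G" "X \<subseteq> pverts G" "W \<inter> X = {}"
    and p: "copy_ended_path G W p" and q: "copy_ended_path G X q"
  shows "copy_ended_path G (W \<union> X) (p @ q)"
proof -
  have "(last p, hd q) \<in> parcs (complement (mycielski G))" if "p \<noteq> []" "q \<noteq> []"
    using p q that W by (auto simp: copy_ended_path_def mycielski_complement_arcs[OF G])
  then have "successively (\<lambda>x y. (x, y) \<in> parcs (complement (mycielski G))) (p @ q)"
    using p q by (auto simp: successively_append_iff copy_ended_path_def)
  moreover have "set p \<inter> set q = {}"
    using p q W by (auto simp: copy_ended_path_def)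
  then have "distinct (p @ q)"
    using p q by (auto simp: copy_ended_path_def)
  moreover have "set (p @ q) = Orig ` (W \<union> X) \<union> Copy ` (W \<union> X)"
    using p q by (auto simp: copy_ended_path_def)
  moreover have "hd (p @ q) \<in> Copy ` (W \<union> X) \<and> last (p @ q) \<in> Copy ` (W \<union> X)" if "p @ q \<noteq> []"
    using p q that by (auto simp: copy_ended_path_def hd_append last_append)
  ultimately show ?thesis
    by (simp only: copy_ended_path_def) blast
qed

text \<open>With four leaves, \<open>Orig z\<close> and \<open>Copy z\<close> each link the
  originals of two leaves, and the two resulting segments are joined through the copies of two
  leaves. Smaller stars need lists of their own to end in copies.\<close>

lemma star_copy_ended_path:
  assumes G: "pair_graph G" and L: "finite L" "L \<noteq> {}" "card L \<le> 4"
    and star: "\<And>l. l \<in> L \<Longrightarrow> (l, z) \<in> parcs (complement G)"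
  obtains q where "copy_ended_path G (insert z L) q"
proof -
  interpret H: pair_graph "complement G"
    by (rule pair_graph_complement) fact
  have "sym (parcs (complement G))"
    using H.pair_sym_arcs by (simp add: symmetric_def)
  then have adj: "(l, z) \<in> parcs (complement G) \<and> (z, l) \<in> parcs (complement G)"
    if "l \<in> L" for l
    using star[OF that] by (auto dest: symD)
  have V: "l \<in> pverts G \<and> z \<in> pverts G \<and> l \<noteq> z \<and> z \<noteq> l" if "l \<in> L" for l
    using star[OF that] by (auto simp: complement_def)
  note simps = copy_ended_path_def mycielski_complement_arcs[OF G]
  obtain xs where xs: "distinct xs" "set xs = L" "length xs = card L"
    using finite_distinct_list[OF L(1)] distinct_card by metis
  have facts: "\<forall>l \<in> set xs. (l, z) \<in> parcs (complement G) \<and> (z, l) \<in> parcs (complement G)"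
    "\<forall>l \<in> set xs. l \<in> pverts G \<and> z \<in> pverts G \<and> l \<noteq> z \<and> z \<noteq> l" "distinct xs"
    using adj V xs by auto
  have "length xs = 1 \<or> length xs = 2 \<or> length xs = 3 \<or> length xs = 4"
    using L xs(3) card_gt_0_iff[of L] by linarith
  then have "\<exists>q. copy_ended_path G (insert z (set xs)) q"
  proof (elim disjE)
    assume "length xs = 1"
    then obtain a where "xs = [a]"
      by (auto simp: length_Suc_conv)
    then have "copy_ended_path G (insert z (set xs)) [Copy z, Orig a, Orig z, Copy a]"
      using facts by (auto simp: simps)
    then show ?thesis ..
  next
    assume "length xs = 2"
    then obtain a b where "xs = [a, b]"
      by (auto simp: length_Suc_conv numeral_eq_Suc)
    then have "copy_ended_path G (insert z (set xs))
        [Copy z, Copy a, Orig a, Orig z, Orig b, Copy b]"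
      using facts by (auto simp: simps)
    then show ?thesis ..
  next
    assume "length xs = 3"
    then obtain a b c where "xs = [a, b, c]"
      by (auto simp: length_Suc_conv numeral_eq_Suc)
    then have "copy_ended_path G (insert z (set xs))
        [Copy b, Copy a, Orig a, Orig z, Orig b, Copy z, Orig c, Copy c]"
      using facts by (auto simp: simps)
    then show ?thesis ..
  next
    assume "length xs = 4"
    then obtain a b c d where "xs = [a, b, c, d]"
      by (auto simp: length_Suc_conv numeral_eq_Suc)
    then have "copy_ended_path G (insert z (set xs))
        [Copy a, Orig a, Orig z, Orig b, Copy b, Copy c, Orig c, Copy z, Orig d, Copy d]"
      using facts by (auto simp: simps)
    then show ?thesis ..
  qed
  then show thesis
    using that xs(2) by auto
qed

lemma star_assignment_copy_ended_path:
  assumes G: "pair_graph G" and sa: "star_assignment 4 (parcs (complement G)) D g"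
  obtains q where "copy_ended_path G (D \<union> g ` D) q"
proof -
  have fin: "finite D" and arc: "\<And>d. d \<in> D \<Longrightarrow> (d, g d) \<in> parcs (complement G)"
    and centre: "\<And>d. d \<in> D \<Longrightarrow> g d \<notin> D" and fibre: "\<And>c. card {d \<in> D. g d = c} \<le> 4"
    using sa by (auto simp: star_assignment_def)
  have V: "d \<in> pverts G" "g d \<in> pverts G" if "d \<in> D" for d
    using arc[OF that] by (auto simp: complement_def)
  have "\<exists>q. copy_ended_path G (Z \<union> {d \<in> D. g d \<in> Z}) q" if "finite Z" "Z \<subseteq> g ` D" for Z
    using that
  proof (induction Z rule: finite_induct)
    case empty
    have "copy_ended_path G {} []"
      by (simp add: copy_ended_path_def)
    then show ?case
      by auto
  next
    case (insert z Z)
    obtain q where q: "copy_ended_path G (Z \<union> {d \<in> D. g d \<in> Z}) q"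
      using insert by auto
    define L where "L = {d \<in> D. g d = z}"
    have "finite L" "L \<noteq> {}" "card L \<le> 4" "\<And>l. l \<in> L \<Longrightarrow> (l, z) \<in> parcs (complement G)"
      using fin insert.prems fibre arc by (auto simp: L_def)
    then obtain p where p: "copy_ended_path G (insert z L) p"
      by (rule star_copy_ended_path[OF G])
    \<comment> \<open>Stars with different centres are disjoint because a leaf has one centre and no
      centre is a leaf.\<close>
    have "(insert z L) \<inter> (Z \<union> {d \<in> D. g d \<in> Z}) = {}"
      using insert centre by (auto simp: L_def)
    moreover have "insert z L \<subseteq> pverts G" "Z \<union> {d \<in> D. g d \<in> Z} \<subseteq> pverts G"
      using insert.prems V by (auto simp: L_def)
    ultimately have "copy_ended_path G (insert z L \<union> (Z \<union> {d \<in> D. g d \<in> Z})) (p @ q)"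
      using copy_ended_path_append[OF G _ _ _ p q] by blast
    moreover have "insert z L \<union> (Z \<union> {d \<in> D. g d \<in> Z}) = insert z Z \<union> {d \<in> D. g d \<in> insert z Z}"
      by (auto simp: L_def)
    ultimately show ?case
      by auto
  qed
  from this[of "g ` D"] fin have "\<exists>q. copy_ended_path G (g ` D \<union> {d \<in> D. g d \<in> g ` D}) q"
    by simp
  moreover have "g ` D \<union> {d \<in> D. g d \<in> g ` D} = D \<union> g ` D"
    by auto
  ultimately show thesis
    using that by auto
qed

section \<open>Covering the unmatched vertices and the apex\<close>

text \<open>This relativises \<open>path_cover\<close>, which is the case
  \<open>X = pverts H\<close>, so that covers can be assembled one path at a time.\<close>

definition partial_path_cover :: "'a list set \<Rightarrow> 'a set \<Rightarrow> 'a pair_pre_digraph \<Rightarrow> bool" where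
  "partial_path_cover P X H \<longleftrightarrow> finite P \<and> (\<forall>p \<in> P. vpath p (with_proj H)) \<and>
     (\<forall>p \<in> P. \<forall>q \<in> P. p \<noteq> q \<longrightarrow> set p \<inter> set q = {}) \<and> (\<Union>p \<in> P. set p) = X"

lemma partial_path_cover_insert:
  assumes "partial_path_cover P X H" "vpath p (with_proj H)" "set p \<inter> X = {}"
  shows "partial_path_cover (insert p P) (set p \<union> X) H"
  using assms unfolding partial_path_cover_def by blast

text \<open>Two vertices share a path through their adjacent copies; a single one left over forms a
  path with its own copy, whence the rounding up.\<close>

lemma partial_path_cover_pairs:
  assumes G: "pair_graph G"
  shows "finite U \<Longrightarrow> U \<subseteq> pverts G \<Longrightarrow>
    \<exists>P. partial_path_cover P (Orig ` U \<union> Copy ` U) (complement (mycielski G)) \<and>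
      card P \<le> (card U + 1) div 2"
proof (induction "card U" arbitrary: U rule: less_induct)
  case less
  note simps = vpath_with_proj_iff pverts_complement_mycielski mycielski_complement_arcs[OF G]
  let ?H = "complement (mycielski G)"
  obtain xs where xs: "distinct xs" "set xs = U"
    using finite_distinct_list[OF less.prems(1)] by auto
  consider "xs = []" | x where "xs = [x]" | x y zs where "xs = x # y # zs"
    by (metis list.exhaust)
  then show ?case
  proof cases
    case 1
    then have "partial_path_cover {} (Orig ` U \<union> Copy ` U) ?H"
      using xs by (simp add: partial_path_cover_def)
    then show ?thesis
      by (intro exI[of _ "{}"]) simp
  next
    case (2 x)
    then have "partial_path_cover {[Orig x, Copy x]} (Orig ` U \<union> Copy ` U) ?H"
      using xs less.prems by (auto simp: partial_path_cover_def simps)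
    then show ?thesis
      using 2 xs by (intro exI[of _ "{[Orig x, Copy x]}"]) auto
  next
    case (3 x y zs)
    let ?p = "[Orig x, Copy x, Copy y, Orig y]"
    have U: "U = {x, y} \<union> set zs" "x \<noteq> y" "x \<notin> set zs" "y \<notin> set zs"
      using 3 xs by auto
    then have card_U: "card U = card (set zs) + 2"
      by auto
    then obtain P where P: "partial_path_cover P (Orig ` set zs \<union> Copy ` set zs) ?H"
        "card P \<le> (card (set zs) + 1) div 2"
      using less.hyps[of "set zs"] less.prems U(1) by auto
    have "vpath ?p (with_proj ?H)"
      using U less.prems by (auto simp: simps)
    then have "partial_path_cover (insert ?p P) (set ?p \<union> (Orig ` set zs \<union> Copy ` set zs)) ?H"
      by (rule partial_path_cover_insert[OF P(1)]) (use U in auto)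
    moreover have "set ?p \<union> (Orig ` set zs \<union> Copy ` set zs) = Orig ` U \<union> Copy ` U"
      using U by auto
    moreover have "card (insert ?p P) \<le> (card U + 1) div 2"
      using P(2) card_insert_le_m1[of "Suc (card P)" P ?p] card_U by auto
    ultimately show ?thesis
      by metis
  qed
qed

lemma path_covering_number_le:
  assumes "partial_path_cover P (pverts H) H"
  shows "path_covering_number H \<le> card P"
  using assms unfolding path_covering_number_def partial_path_cover_def path_cover_def[symmetric]
  by (auto intro: Least_le)

text \<open>A single path takes in all stars, the apex and up to four vertices of \<open>U\<close>;
  the others are covered in pairs. Nonemptiness of \<open>U\<close> provides an original to attach
  the apex to, as the ends of \<open>q\<close> are copies and not adjacent to it.\<close>

lemma path_covering_number_le_of_stars:
  assumes G: "pair_graph G" and sa: "star_assignment 4 (parcs (complement G)) D g"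
    and U: "U = pverts G - (D \<union> g ` D)" "U \<noteq> {}"
  shows "path_covering_number (complement (mycielski G)) \<le> max 1 ((card U + 1) div 2 - 1)"
proof -
  interpret pair_graph G by fact
  let ?H = "complement (mycielski G)"
  define W where "W = D \<union> g ` D"
  obtain q where q: "copy_ended_path G W q"
    using star_assignment_copy_ended_path[OF G sa] unfolding W_def .
  have "W \<subseteq> pverts G"
    using sa by (auto simp: W_def star_assignment_def complement_def)
  then have V: "pverts G = W \<union> U" "W \<inter> U = {}"
    using U(1) by (auto simp: W_def)
  have finU: "finite U"
    using U by simp
  obtain xs where xs: "distinct xs" "set xs = U"
    using finite_distinct_list[OF finU] by auto
  have q_facts: "distinct q" "set q = Orig ` W \<union> Copy ` W"
      "successively (\<lambda>x y. (x, y) \<in> parcs ?H) q"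
      "q = [] \<or> (\<exists>a b. hd q = Copy a \<and> last q = Copy b \<and> a \<in> W \<and> b \<in> W)"
    using q by (auto simp: copy_ended_path_def)
  note simps = vpath_with_proj_iff pverts_complement_mycielski mycielski_complement_arcs[OF G]
    successively_append_iff successively_Cons hd_append
  consider x where "xs = [x]" | x y where "xs = [x, y]" | x y z where "xs = [x, y, z]"
    | x y z w us where "xs = x # y # z # w # us"
    using U(2) xs(2) by (metis list.exhaust set_empty)
  \<comment> \<open>\<open>us\<close> lists the vertices of \<open>U\<close> left over by the long
    path \<open>p\<close>; it is empty when \<open>U\<close> has at most four elements.\<close>
  then obtain p us where p: "vpath p (with_proj ?H)" "set us \<subseteq> U"
      "set p = insert Apex (Orig ` (pverts G - set us) \<union> Copy ` (pverts G - set us))"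
      "us = [] \<or> card U = card (set us) + 4"
  proof cases
    case (1 x)
    have "vpath (Apex # Orig x # Copy x # q) (with_proj ?H)"
      using 1 xs V q_facts by (auto simp: simps)
    then show ?thesis
      using 1 xs V q_facts by (intro that[of _ "[]"]) auto
  next
    case (2 x y)
    have "vpath (Apex # Orig x # Copy x # q @ [Copy y, Orig y]) (with_proj ?H)"
      using 2 xs V q_facts by (auto simp: simps)
    then show ?thesis
      using 2 xs V q_facts by (intro that[of _ "[]"]) auto
  next
    case (3 x y z)
    have "vpath (Orig x # Copy x # q @ [Copy y, Orig y, Apex, Orig z, Copy z]) (with_proj ?H)"
      using 3 xs V q_facts by (auto simp: simps)
    then show ?thesis
      using 3 xs V q_facts by (intro that[of _ "[]"]) auto
  next
    case (4 x y z w us)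
    let ?p = "Orig x # Copy x # q @ [Copy y, Orig y, Apex, Orig z, Copy z, Copy w, Orig w]"
    have path: "vpath ?p (with_proj ?H)"
      using 4 xs V q_facts by (auto simp: simps)
    have sub: "set us \<subseteq> U"
      using 4 xs(2) by auto
    have card: "card U = card (set us) + 4"
      using 4 xs distinct_card[OF xs(1)] distinct_card[of us] by auto
    have "pverts G - set us = W \<union> {x, y, z, w}"
      using 4 xs V by auto
    then have "set ?p = insert Apex (Orig ` (pverts G - set us) \<union> Copy ` (pverts G - set us))"
      using q_facts(2) by auto
    from that[OF path sub this] card show ?thesis
      by blast
  qed
  have "set us \<subseteq> pverts G"
    using p(2) V by auto
  then obtain P where P: "partial_path_cover P (Orig ` set us \<union> Copy ` set us) ?H"
      "card P \<le> (card (set us) + 1) div 2"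
    using partial_path_cover_pairs[OF G, of "set us"] by auto
  have "partial_path_cover (insert p P) (set p \<union> (Orig ` set us \<union> Copy ` set us)) ?H"
    by (rule partial_path_cover_insert[OF P(1) p(1)]) (use p(3) in auto)
  moreover have "set p \<union> (Orig ` set us \<union> Copy ` set us) = pverts ?H"
    using p(3) \<open>set us \<subseteq> pverts G\<close> by (auto simp: pverts_complement_mycielski)
  ultimately have "path_covering_number ?H \<le> card (insert p P)"
    using path_covering_number_le by metis
  also have "\<dots> \<le> Suc (card P)"
    by (rule card_insert_le_m1) simp_all
  \<comment> \<open>For empty \<open>us\<close> the bound on \<open>card P\<close> is 0. Otherwise
    one path replaces the two that four vertices would need in pairs, which accounts for the
    subtracted 1.\<close>
  also have "\<dots> \<le> max 1 ((card U + 1) div 2 - 1)"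
    using P(2) p(4) by auto
  finally show ?thesis .
qed

text \<open>Extends the bound to the case without unmatched vertices. If \<open>G\<close> is empty,
  the apex alone is a path; otherwise a leaf is released from its star.\<close>

lemma path_covering_number_le_star_deficiency:
  assumes G: "pair_graph G" and sa: "star_assignment 4 (parcs (complement G)) D g"
  shows "path_covering_number (complement (mycielski G)) \<le>
    max 1 ((card (pverts G) - card (D \<union> g ` D) + 1) div 2 - 1)"
proof -
  interpret pair_graph G by fact
  let ?U = "pverts G - (D \<union> g ` D)"
  have sub: "D \<union> g ` D \<subseteq> pverts G"
    using sa by (auto simp: star_assignment_def complement_def)
  have card_U: "card ?U = card (pverts G) - card (D \<union> g ` D)"
    using sub finite_subset[OF sub] by (simp add: card_Diff_subset)
  consider "?U \<noteq> {}" | "pverts G = {}" | d where "d \<in> D" "?U = {}"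
    by blast
  then show ?thesis
  proof cases
    case 1
    then show ?thesis
      using path_covering_number_le_of_stars[OF G sa refl] card_U by simp
  next
    case 2
    then have "partial_path_cover {[Apex]} (pverts (complement (mycielski G)))
        (complement (mycielski G))"
      by (auto simp: partial_path_cover_def vpath_with_proj_iff pverts_complement_mycielski)
    from path_covering_number_le[OF this] show ?thesis
      by simp
  next
    \<comment> \<open>Dropping the leaf \<open>d\<close> leaves \<open>d\<close> unmatched, and
      possibly its centre. With one or two unmatched vertices the bound is still 1.\<close>
    case (3 d)
    let ?D = "D - {d}"
    let ?U' = "pverts G - (?D \<union> g ` ?D)"
    have fin: "finite D" and centre: "\<And>d. d \<in> D \<Longrightarrow> g d \<notin> D"
      using sa by (auto simp: star_assignment_def)
    have "card {x \<in> ?D. g x = c} \<le> 4" for c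
    proof -
      have "card {x \<in> ?D. g x = c} \<le> card {x \<in> D. g x = c}"
        using fin by (intro card_mono) auto
      also have "\<dots> \<le> 4"
        using sa by (simp add: star_assignment_def)
      finally show ?thesis .
    qed
    then have sa': "star_assignment 4 (parcs (complement G)) ?D g"
      using sa by (auto simp: star_assignment_def)
    have "d \<in> ?U'"
      using sub 3 centre by auto
    then have ne: "?U' \<noteq> {}"
      by blast
    have "?U' \<subseteq> {d, g d}"
      using 3 by blast
    then have "card ?U' \<le> card {d, g d}"
      by (intro card_mono) auto
    also have "\<dots> \<le> 2"
      by (simp add: card_insert_if)
    finally show ?thesis
      using path_covering_number_le_of_stars[OF G sa' refl ne] by linarith
  qed
qed

section \<open>Combination of the two bounds\<close>

theorem theorem3p3:
  fixes G :: "'a pair_pre_digraph"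
  assumes "pair_graph G"
  shows "(star_deficiency 4 (complement G) \<le> 4
           \<longleftrightarrow> path_covering_number (complement (mycielski G)) = 1)
       \<and> (\<forall>r::int. r \<ge> 3 \<longrightarrow>
           (\<lceil>real (star_deficiency 4 (complement G)) / 2\<rceil> = r
             \<longleftrightarrow> int (path_covering_number (complement (mycielski G))) = r - 1))"
proof -
  interpret G: pair_graph G by fact
  let ?H = "complement G"
  let ?M = "complement (mycielski G)"
  have H: "pair_graph ?H"
    using assms by (rule pair_graph_complement)
  define i where "i = star_deficiency 4 ?H"
  define p where "p = path_covering_number ?M"
  let ?cards = "{card (pverts S) | S. star_matching 4 S ?H}"
  have cards: "finite ?cards" "?cards \<noteq> {}"
    using finite_star_matching_cards[OF H] star_matching_null[OF H] by auto
  have verts_H: "pverts ?H = pverts G"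
    by (simp add: complement_def)
  have upper: "p \<le> max 1 ((i + 1) div 2 - 1)"
  proof -
    obtain S where S: "star_matching 4 S ?H" "card (pverts S) = star_matching_number 4 ?H"
      using Max_in[OF cards] unfolding star_matching_number_def by force
    obtain D g where "star_assignment 4 (parcs ?H) D g" "D \<union> g ` D = pverts S"
      using S(1) by (rule star_matching_imp_assignment)
    then show ?thesis
      using path_covering_number_le_star_deficiency[OF assms] S(2)
      by (metis i_def p_def star_deficiency_def verts_H)
  qed
  \<comment> \<open>The cover by single vertices shows that the \<open>LEAST\<close> in the path
    covering number is attained.\<close>
  have "\<exists>P. path_cover P ?M"
  proof
    show "path_cover ((\<lambda>x. [x]) ` pverts ?M) ?M"
      by (auto simp: path_cover_def vpath_with_proj_iff pverts_complement_mycielski)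
  qed
  then have "\<exists>P. path_cover P ?M \<and> card P = p"
    unfolding p_def path_covering_number_def
    using LeastI_ex[of "\<lambda>k. \<exists>P. path_cover P ?M \<and> card P = k"] by blast
  then obtain P where P: "path_cover P ?M" "card P = p"
    by blast
  \<comment> \<open>The apex is always present, so a cover has at least one path even for empty
    \<open>G\<close>.\<close>
  have "P \<noteq> {}" "finite P"
    using P(1) by (auto simp: path_cover_def pverts_complement_mycielski)
  then have p_pos: "1 \<le> p"
    using P(2) by (auto simp: Suc_le_eq card_gt_0_iff)
  have lower: "i \<le> 2 * p + 2"
  proof -
    obtain D g where Dg: "star_assignment 4 (parcs ?H) D g"
        "card (pverts G) \<le> card (D \<union> g ` D) + 2 * card P + 2"
      using assms P(1) by (rule path_cover_imp_star_assignment)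
    obtain S where S: "star_matching 4 S ?H" "pverts S = D \<union> g ` D"
      using H Dg(1) by (rule assignment_imp_star_matching)
    have "card (pverts S) \<in> ?cards"
      using S(1) by blast
    then have "card (D \<union> g ` D) \<le> star_matching_number 4 ?H"
      using Max_ge[OF cards(1)] S(2) by (simp add: star_matching_number_def)
    then show ?thesis
      using Dg(2) P(2) by (simp add: i_def star_deficiency_def verts_H)
  qed
  \<comment> \<open>Let \<open>c\<close> be this value. Then \<open>lower\<close> gives
    \<open>c - 1 \<le> p\<close>, which with \<open>upper\<close> and \<open>p_pos\<close> yields
    \<open>p = max 1 (c - 1)\<close>. Both claims follow, since \<open>i \<le> 4\<close> means
    \<open>c \<le> 2\<close>.\<close>
  have "\<lceil>real i / 2\<rceil> = int ((i + 1) div 2)"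
    by linarith
  then show ?thesis
    unfolding i_def[symmetric] p_def[symmetric] using upper lower p_pos
    by (auto simp: max_def split: if_splits)
qed


end
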